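(* Let $n\ge2$. Suppose that the noise satisfies (A4) and the initial state $x(1)\in\mathbb{R}^n$ is not in consensus (its entries are not all equal). Then $$\rho_1(t)=\Theta\Big(\frac1t\Big).$$
   Context: System. There are $n$ agents with scalar states $x_i(t)$, $t=1,2,\dots$, and deterministic initial state $x(1)\in\mathbb{R}^n$. At each time $t$ the topology is a weighted digraph $\mathcal{G}(t)=(\mathcal{V},\mathcal{E}(t),\mathcal{A}(t))$ without self-loops on $\mathcal{V}=\{1,\dots,n\}$; $\mathcal{N}_i(t)=\{j:(j,i)\in\mathcal{E}(t)\}$ is the neighbor set of $i$, and the edge $(j,i)$ has weight $a_{ij}^t$ with $1\le a_{ij}^t\le a_{\max}$ (standing assumption, $a_{\max}\ge1$ a constant). The dynamics is $$x_i(t+1)=x_i(t)+a(t)\sum_{j\in\mathcal{N}_i(t)}a_{ij}^t\,[x_j(t)-x_i(t)+w_{ji}(t)],\qquad t\ge1,\ 1\le i\le n,$$ where $a(t)\ge0$ is the (deterministic) gain and $w_{ji}(t)$ are random noises. For $x\in\mathbb{R}^n$, $x_{\rm ave}=\frac1n\sum_i x_i$ and $V(x)=\sum_{i=1}^n(x_i-x_{\rm ave})^2$. The fastest convergence rate under the best topologies is $$\rho_1(t):=\inf_{a(1)\ge0,\dots,a(t-1)\ge0}\ \inf_{\mathcal{G}(1),\dots,\mathcal{G}(t-1)}E[V(x(t))],$$ where the inner infimum is over all sequences $\mathcal{G}(1),\dots,\mathcal{G}(t-1)$ of weighted digraphs without self-loops on the vertex set $\mathcal{V}=\{1,\dots,n\}$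 with all edge weights in $[1,a_{\max}]$; it depends on the noises and on $x(1)$. $g_1(t)=\Theta(g_2(t))$ means there are constants $c_2>c_1>0$ and $t_0>0$ with $c_1g_2(t)\le g_1(t)\le c_2g_2(t)$ for all $t\ge t_0$. (A4): there are constants $0<\underline v\le\overline v$ (independent of the topology sequence) such that for any topology sequence the noises $\{w_{ji}(t)\}$ are zero-mean random variables satisfying: (i) $E[w_{j_1i_1}(t_1)w_{j_2i_2}(t_2)]=0$ for all $t_1\ne t_2$, $(j_1,i_1)\in\mathcal{E}(t_1)$, $(j_2,i_2)\in\mathcal{E}(t_2)$; (ii) for any non-empty edge set $\mathcal{E}(t)$ and real numbers $\{c_{ji}\}$, $$\underline v\sum_{(j,i)\in\mathcal{E}(t)}c_{ji}^2\le E\Big[\sum_{(j,i)\in\mathcal{E}(t)}c_{ji}w_{ji}(t)\Big]^2\le\overline v\sum_{(j,i)\in\mathcal{E}(t)}c_{ji}^2 .$$ *)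

theory Defs
  imports "HOL-Probability.Probability"
begin

text \<open>A weighted digraph on the vertex set \<open>UNIV :: 'n set\<close>. The pair \<open>(j, i)\<close> is the edge
  from \<open>j\<close> to \<open>i\<close>, and its weight is the adjacency entry \<open>weight g i j\<close> (receiver first).\<close>

record 'n wdigraph =
  edges :: "('n \<times> 'n) set"
  weight :: "'n \<Rightarrow> 'n \<Rightarrow> real"

text \<open>Adjacency entries of non-edges are 0, so that a weighted digraph has exactly one
  representation.\<close>

definition admissible :: "real \<Rightarrow> 'n wdigraph \<Rightarrow> bool" where
  "admissible amax g \<longleftrightarrow>
     (\<forall>i. (i, i) \<notin> edges g) \<and>
     (\<forall>i j. (j, i) \<in> edges g \<longrightarrow> 1 \<le> weight g i j \<and> weight g i j \<le> amax) \<and>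
     (\<forall>i j. (j, i) \<notin> edges g \<longrightarrow> weight g i j = 0)"

definition neighbors :: "'n wdigraph \<Rightarrow> 'n \<Rightarrow> 'n set" where
  "neighbors g i = {j. (j, i) \<in> edges g}"

text \<open>Time starts at 1; the values at index 0 of gain and topology sequences are never used.\<close>

definition topology_seqs :: "real \<Rightarrow> (nat \<Rightarrow> 'n wdigraph) set" where
  "topology_seqs amax = {G. \<forall>t\<ge>1. admissible amax (G t)}"

definition gain_seqs :: "(nat \<Rightarrow> real) set" where
  "gain_seqs = {a. \<forall>t\<ge>1. 0 \<le> a t}"

text \<open>The noises may depend on the topology sequence: \<open>w G t j i\<close> is the noise \<open>w\<^sub>j\<^sub>i(t)\<close> on the
  edge \<open>(j, i)\<close> at time \<open>t\<close> under the topology sequence \<open>G\<close>. Its value is irrelevant when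
  \<open>(j, i)\<close> is not an edge of \<open>G t\<close>.\<close>

type_synonym ('n, 'a) noise =
  "(nat \<Rightarrow> 'n wdigraph) \<Rightarrow> nat \<Rightarrow> 'n \<Rightarrow> 'n \<Rightarrow> 'a \<Rightarrow> real"

text \<open>Finiteness of second moments, implicit in the upper bound of the last clause, is stated
  explicitly because the Bochner integral of a non-integrable function is 0.\<close>

definition noise_A4 ::
    "real \<Rightarrow> 'a measure \<Rightarrow> ('n::finite, 'a) noise \<Rightarrow> bool" where
  "noise_A4 amax M w \<longleftrightarrow>
     (\<exists>vlo vhi. 0 < vlo \<and> vlo \<le> vhi \<and>
       (\<forall>G\<in>topology_seqs amax.
          (\<forall>t\<ge>1. \<forall>(j, i)\<in>edges (G t).
             w G t j i \<in> borel_measurable M \<and>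
             integrable M (\<lambda>\<omega>. (w G t j i \<omega>)\<^sup>2) \<and>
             integrable M (w G t j i) \<and>
             (\<integral>\<omega>. w G t j i \<omega> \<partial>M) = 0) \<and>
          (\<forall>t1\<ge>1. \<forall>t2\<ge>1. t1 \<noteq> t2 \<longrightarrow>
             (\<forall>(j1, i1)\<in>edges (G t1). \<forall>(j2, i2)\<in>edges (G t2).
                (\<integral>\<omega>. w G t1 j1 i1 \<omega> * w G t2 j2 i2 \<omega> \<partial>M) = 0)) \<and>
          (\<forall>t\<ge>1. edges (G t) \<noteq> {} \<longrightarrow>
             (\<forall>c :: 'n \<Rightarrow> 'n \<Rightarrow> real.
                vlo * (\<Sum>(j, i)\<in>edges (G t). (c j i)\<^sup>2)
                  \<le> (\<integral>\<omega>. (\<Sum>(j, i)\<in>edges (G t). c j i * w G t j i \<omega>)\<^sup>2 \<partial>M) \<and>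
                (\<integral>\<omega>. (\<Sum>(j, i)\<in>edges (G t). c j i * w G t j i \<omega>)\<^sup>2 \<partial>M)
                  \<le> vhi * (\<Sum>(j, i)\<in>edges (G t). (c j i)\<^sup>2)))))"

text \<open>\<open>state w a G x1 t \<omega>\<close> is \<open>x(t)\<close> for \<open>t \<ge> 1\<close>, with \<open>x(1) = x1\<close>; the value at \<open>t = 0\<close> is
  a dummy.\<close>

primrec state ::
    "('n::finite, 'a) noise \<Rightarrow> (nat \<Rightarrow> real) \<Rightarrow> (nat \<Rightarrow> 'n wdigraph) \<Rightarrow> real ^ 'n
      \<Rightarrow> nat \<Rightarrow> 'a \<Rightarrow> real ^ 'n" where
  "state w a G x1 0 \<omega> = x1"
| "state w a G x1 (Suc t) \<omega> =
     (if t = 0 then x1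
      else (\<chi> i. state w a G x1 t \<omega> $ i +
             a t * (\<Sum>j\<in>neighbors (G t) i. weight (G t) i j *
               (state w a G x1 t \<omega> $ j - state w a G x1 t \<omega> $ i + w G t j i \<omega>))))"

definition x_ave :: "real ^ 'n::finite \<Rightarrow> real" where
  "x_ave x = (\<Sum>i\<in>UNIV. x $ i) / real CARD('n)"

definition V :: "real ^ 'n::finite \<Rightarrow> real" where
  "V x = (\<Sum>i\<in>UNIV. (x $ i - x_ave x)\<^sup>2)"

text \<open>The infima range over infinite sequences, of which the dynamics up to time \<open>t\<close> uses only
  the entries with indices \<open>1, \<dots>, t - 1\<close>. Both are infima of non-empty sets of non-negative
  reals.\<close>

definition rho1 ::
    "real \<Rightarrow> 'a measure \<Rightarrow> ('n::finite, 'a) noise \<Rightarrow> real ^ 'n \<Rightarrow> nat \<Rightarrow> real" where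
  "rho1 amax M w x1 t =
     (INF a\<in>gain_seqs. INF G\<in>topology_seqs amax. (\<integral>\<omega>. V (state w a G x1 t \<omega>) \<partial>M))"

end

theory Submission
  imports Defs
begin

text \<open>
  Projecting the dynamics onto deviations from the average, one step consists of a linear
  contraction, given by the gain and the graph Laplacian, and of fresh noise scaled by the gain.
  The state depends linearly on earlier noises only, so the noise is orthogonal to it in \<open>L\<^sup>2\<close>, and
  with \<open>v(t) = E V(x(t))\<close> the mean square splits (\<open>expectation_V_state_Suc\<close>) as
  \<open>v(t + 1) = E V(x(t) + a(t) L x(t)) + a(t)\<^sup>2 E V(noise)\<close>.

  Lower bound. With \<open>K\<close> a uniform bound on all Laplacians, a gain \<open>a \<le> 1/K\<close> contracts \<open>V\<close>
  at best by \<open>(1 - a K)\<^sup>2\<close> (\<open>V_drift_ge\<close>), while any gain on a graph with an edge injects noise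
  energy at least proportional to \<open>a\<^sup>2\<close> (\<open>expectation_V_noise_input_ge\<close>). Even the gain that balances these two
  effects optimally only achieves \<open>1/v(t + 1) \<le> 1/v(t) + 1/c\<close> for a constant \<open>c\<close>
  (\<open>inverse_growth_step\<close>). So \<open>1/v(t)\<close> grows at most linearly, from a finite initial value because
  the initial state is not in consensus, and the bound is uniform in gains and topologies.

  Upper bound. The complete graph with unit weights and gain \<open>1/(n t)\<close> contracts all deviations by
  \<open>(t - 1)/t\<close>, while the noise energy is at most a constant divided by \<open>t\<^sup>2\<close>. Hence
  \<open>t\<^sup>2 v(t + 1)\<close> grows at most by a constant per step, which gives \<open>v(t + 1) = O(1/t)\<close>
  (\<open>expectation_V_state_complete_graph\<close>).
\<close>

section \<open>Square-integrable and orthogonal random variables\<close>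

definition square_integrable :: "'a measure \<Rightarrow> ('a \<Rightarrow> real) \<Rightarrow> bool" where
  "square_integrable M f \<longleftrightarrow> f \<in> borel_measurable M \<and> integrable M (\<lambda>\<omega>. (f \<omega>)\<^sup>2)"

definition orthogonal_rv :: "'a measure \<Rightarrow> ('a \<Rightarrow> real) \<Rightarrow> ('a \<Rightarrow> real) \<Rightarrow> bool" where
  "orthogonal_rv M f g \<longleftrightarrow>
     square_integrable M f \<and> square_integrable M g \<and> (\<integral>\<omega>. f \<omega> * g \<omega> \<partial>M) = 0"

lemma square_integrable_integrable_mult:
  assumes "square_integrable M f" "square_integrable M g"
  shows "integrable M (\<lambda>\<omega>. f \<omega> * g \<omega>)"
proof (rule Bochner_Integration.integrable_bound)
  show "integrable M (\<lambda>\<omega>. (f \<omega>)\<^sup>2 + (g \<omega>)\<^sup>2)"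
    using assms by (auto simp: square_integrable_def)
  show "(\<lambda>\<omega>. f \<omega> * g \<omega>) \<in> borel_measurable M"
    using assms by (auto simp: square_integrable_def)
  have "\<bar>x * y\<bar> \<le> x\<^sup>2 + y\<^sup>2" for x y :: real
  proof -
    have "2 * (\<bar>x\<bar> * \<bar>y\<bar>) \<le> x\<^sup>2 + y\<^sup>2"
      using sum_squares_bound[of "\<bar>x\<bar>" "\<bar>y\<bar>"] by simp
    moreover have "0 \<le> \<bar>x\<bar> * \<bar>y\<bar>" by simp
    ultimately show ?thesis unfolding abs_mult by linarith
  qed
  then show "AE \<omega> in M. norm (f \<omega> * g \<omega>) \<le> norm ((f \<omega>)\<^sup>2 + (g \<omega>)\<^sup>2)"
    by simp
qed

lemma square_integrable_zero: "square_integrable M (\<lambda>\<omega>. 0)"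
  by (simp add: square_integrable_def)

lemma square_integrable_add:
  assumes "square_integrable M f" "square_integrable M g"
  shows "square_integrable M (\<lambda>\<omega>. f \<omega> + g \<omega>)"
  using assms square_integrable_integrable_mult[OF assms]
  by (auto simp: square_integrable_def power2_sum mult.assoc)

lemma square_integrable_cmult:
  "square_integrable M f \<Longrightarrow> square_integrable M (\<lambda>\<omega>. c * f \<omega>)"
  by (auto simp: square_integrable_def power_mult_distrib)

lemma orthogonal_rv_sym: "orthogonal_rv M f g \<Longrightarrow> orthogonal_rv M g f"
  by (simp add: orthogonal_rv_def mult.commute)

lemma orthogonal_rv_zero: "square_integrable M g \<Longrightarrow> orthogonal_rv M (\<lambda>\<omega>. 0) g"
  by (simp add: orthogonal_rv_def square_integrable_zero)

lemma orthogonal_rv_add: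
  assumes "orthogonal_rv M f h" "orthogonal_rv M g h"
  shows "orthogonal_rv M (\<lambda>\<omega>. f \<omega> + g \<omega>) h"
  using assms square_integrable_integrable_mult[of M f h] square_integrable_integrable_mult[of M g h]
  by (auto simp: orthogonal_rv_def square_integrable_add distrib_right)

lemma orthogonal_rv_cmult:
  "orthogonal_rv M f h \<Longrightarrow> orthogonal_rv M (\<lambda>\<omega>. c * f \<omega>) h"
  by (auto simp: orthogonal_rv_def square_integrable_cmult mult.assoc)

lemma orthogonal_rv_sum:
  assumes "square_integrable M h" "\<And>i. i \<in> I \<Longrightarrow> orthogonal_rv M (f i) h"
  shows "orthogonal_rv M (\<lambda>\<omega>. \<Sum>i\<in>I. f i \<omega>) h"
  using assms(2)
  by (induction I rule: infinite_finite_induct)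
     (auto intro: orthogonal_rv_zero orthogonal_rv_add assms(1))

lemma orthogonal_rv_linear:
  fixes X :: "'a \<Rightarrow> real ^ 'n::finite" and F :: "real ^ 'n \<Rightarrow> real ^ 'm::finite"
  assumes "linear F" "\<And>i. orthogonal_rv M (\<lambda>\<omega>. X \<omega> $ i) h"
  shows "orthogonal_rv M (\<lambda>\<omega>. F (X \<omega>) $ k) h"
proof -
  have "F x $ k = (matrix F *v x) $ k" for x
    using fun_cong[OF matrix_vector_mul(2)[OF assms(1)], of x] by (simp only:)
  then have "F x $ k = (\<Sum>i\<in>UNIV. matrix F $ k $ i * x $ i)" for x
    by (simp only: matrix_vector_mult_def vec_lambda_beta)
  moreover have "square_integrable M h"
    using assms(2) by (auto simp: orthogonal_rv_def)
  ultimately show ?thesis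
    by (auto intro!: orthogonal_rv_sum orthogonal_rv_cmult assms(2))
qed

text \<open>Every square-integrable variable is orthogonal to 0, so the linear-image rule for
  orthogonality covers square-integrability as well.\<close>

lemma square_integrable_iff_orthogonal_rv_zero:
  "square_integrable M f \<longleftrightarrow> orthogonal_rv M f (\<lambda>\<omega>. 0)"
  by (simp add: orthogonal_rv_def square_integrable_zero)

lemma square_integrable_linear:
  fixes X :: "'a \<Rightarrow> real ^ 'n::finite" and F :: "real ^ 'n \<Rightarrow> real ^ 'm::finite"
  assumes "linear F" "\<And>i. square_integrable M (\<lambda>\<omega>. X \<omega> $ i)"
  shows "square_integrable M (\<lambda>\<omega>. F (X \<omega>) $ k)"
  using assms orthogonal_rv_linear[of F M X "\<lambda>\<omega>. 0"]
  unfolding square_integrable_iff_orthogonal_rv_zero by blast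

section \<open>The disagreement vector and the Laplacian\<close>

definition deviation :: "real ^ 'n::finite \<Rightarrow> real ^ 'n" where
  "deviation x = (\<chi> i. x $ i - x_ave x)"

lemma x_ave_add: "x_ave (x + y) = x_ave x + x_ave y"
  by (simp add: x_ave_def sum.distrib add_divide_distrib)

lemma x_ave_scaleR: "x_ave (c *\<^sub>R x) = c * x_ave x"
  by (simp add: x_ave_def sum_distrib_left)

lemma linear_deviation: "linear deviation"
  by (rule linearI) (auto simp: deviation_def x_ave_add x_ave_scaleR vec_eq_iff algebra_simps)

lemma V_eq_norm_deviation: "V x = (norm (deviation x))\<^sup>2"
  unfolding V_def deviation_def power2_norm_eq_inner by (simp add: inner_vec_def power2_eq_square)

lemma V_nonneg: "0 \<le> V x"
  by (simp add: V_eq_norm_deviation)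

lemma V_scaleR: "V (c *\<^sub>R x) = c\<^sup>2 * V x"
  by (simp add: V_eq_norm_deviation linear_scale[OF linear_deviation] power_mult_distrib)

lemma V_add: "V (x + y) = V x + 2 * (deviation x \<bullet> deviation y) + V y"
  by (simp add: V_eq_norm_deviation linear_add[OF linear_deviation] power2_norm_eq_inner
      inner_add_left inner_add_right inner_commute)

lemma V_pos:
  assumes "x $ i \<noteq> x $ j"
  shows "0 < V x"
proof -
  have "deviation x \<noteq> 0"
    using assms by (auto simp: deviation_def vec_eq_iff) metis
  then show ?thesis by (simp add: V_eq_norm_deviation)
qed

text \<open>The map \<open>deviation\<close> is the orthogonal projection along the all-ones vector: the removed part
  has equal entries, and the entries of a deviation sum to 0.\<close>

lemma norm_deviation_le: "norm (deviation x) \<le> norm x"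
proof -
  let ?c = "x - deviation x"
  have c: "?c $ i = x_ave x" for i by (simp add: deviation_def)
  have "deviation x \<bullet> ?c = x_ave x * (\<Sum>i\<in>UNIV. deviation x $ i)"
    unfolding inner_vec_def c by (simp add: sum_distrib_left mult.commute)
  also have "(\<Sum>i\<in>UNIV. deviation x $ i) = 0"
    by (simp add: deviation_def sum_subtractf x_ave_def)
  finally have "deviation x \<bullet> x = (norm (deviation x))\<^sup>2"
    by (simp add: inner_diff_right power2_norm_eq_inner)
  then have "norm (deviation x) * norm (deviation x) \<le> norm (deviation x) * norm x"
    using norm_cauchy_schwarz[of "deviation x" x] by (simp add: power2_eq_square)
  then show ?thesis
    by (cases "deviation x = 0") auto
qed

definition laplacian :: "'n wdigraph \<Rightarrow> real ^ 'n \<Rightarrow> real ^ 'n::finite" where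
  "laplacian g x = (\<chi> i. \<Sum>j\<in>neighbors g i. weight g i j * (x $ j - x $ i))"

lemma linear_laplacian: "linear (laplacian g)"
  by (rule linearI)
     (auto simp: laplacian_def vec_eq_iff sum.distrib[symmetric] sum_distrib_left algebra_simps
       intro!: sum.cong)

lemma laplacian_deviation: "laplacian g (deviation x) = laplacian g x"
  by (simp add: laplacian_def deviation_def)

text \<open>A crude operator norm bound. Only its uniformity over all admissible graphs matters: it
  limits how fast any topology can contract the disagreement.\<close>

lemma norm_laplacian_le:
  fixes x :: "real ^ 'n::finite"
  assumes "admissible amax g" "0 \<le> amax"
  shows "norm (laplacian g x) \<le> 2 * real CARD('n) ^ 2 * amax * norm x"
proof -
  have term_le: "\<bar>weight g i j * (x $ j - x $ i)\<bar> \<le> 2 * amax * norm x"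
    if "j \<in> neighbors g i" for i j
  proof -
    have "1 \<le> weight g i j" "weight g i j \<le> amax"
      using assms(1) that by (auto simp: admissible_def neighbors_def)
    then have "\<bar>weight g i j\<bar> \<le> amax" by simp
    moreover have "\<bar>x $ j - x $ i\<bar> \<le> 2 * norm x"
      using component_le_norm_cart[of x i] component_le_norm_cart[of x j] by linarith
    ultimately have "\<bar>weight g i j\<bar> * \<bar>x $ j - x $ i\<bar> \<le> amax * (2 * norm x)"
      by (intro mult_mono) (use assms in auto)
    then show ?thesis by (simp add: abs_mult)
  qed
  have "\<bar>laplacian g x $ i\<bar> \<le> real CARD('n) * (2 * amax * norm x)" for i
  proof -
    have "\<bar>laplacian g x $ i\<bar> \<le> (\<Sum>j\<in>neighbors g i. \<bar>weight g i j * (x $ j - x $ i)\<bar>)"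
      unfolding laplacian_def by simp
    also have "\<dots> \<le> real (card (neighbors g i)) * (2 * amax * norm x)"
      by (rule sum_bounded_above) (rule term_le)
    also have "\<dots> \<le> real CARD('n) * (2 * amax * norm x)"
      using assms(2) by (intro mult_right_mono) (auto intro: card_mono)
    finally show ?thesis .
  qed
  then have "(\<Sum>i\<in>UNIV. \<bar>laplacian g x $ i\<bar>) \<le> real CARD('n) * (real CARD('n) * (2 * amax * norm x))"
    by (rule sum_bounded_above)
  then show ?thesis
    using norm_le_l1_cart[of "laplacian g x"] by (simp add: power2_eq_square mult_ac)
qed

text \<open>The Laplacian ignores the consensus component of the state and the projection onto deviations
  does not increase norms, so the reverse triangle inequality bounds the contraction of one
  noise-free step. For large gains this bound degenerates to 0; then the noise term alone has to
  provide the lower bound.\<close>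

lemma V_drift_ge:
  fixes x :: "real ^ 'n::finite"
  assumes "admissible amax g" "0 \<le> amax" "0 \<le> a"
  shows "(max 0 (1 - a * (2 * real CARD('n) ^ 2 * amax)))\<^sup>2 * V x
           \<le> V (x + a *\<^sub>R laplacian g x)"
proof -
  let ?K = "2 * real CARD('n) ^ 2 * amax"
  have "norm (deviation (laplacian g x)) \<le> ?K * norm (deviation x)"
    using norm_deviation_le[of "laplacian g x"] norm_laplacian_le[OF assms(1,2), of "deviation x"]
    by (simp add: laplacian_deviation)
  then have "a * norm (deviation (laplacian g x)) \<le> a * (?K * norm (deviation x))"
    using assms(3) by (rule mult_left_mono)
  moreover have "norm (deviation x) - a * norm (deviation (laplacian g x))
      \<le> norm (deviation (x + a *\<^sub>R laplacian g x))"
    using norm_diff_ineq[of "deviation x" "a *\<^sub>R deviation (laplacian g x)"] assms(3)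
    by (simp add: linear_add[OF linear_deviation] linear_scale[OF linear_deviation])
  ultimately have "max 0 (1 - a * ?K) * norm (deviation x)
      \<le> norm (deviation (x + a *\<^sub>R laplacian g x))"
    by (auto simp: max_def algebra_simps)
  then have "(max 0 (1 - a * ?K) * norm (deviation x))\<^sup>2
      \<le> (norm (deviation (x + a *\<^sub>R laplacian g x)))\<^sup>2"
    by (intro power_mono) auto
  then show ?thesis
    by (simp add: V_eq_norm_deviation power_mult_distrib)
qed

definition complete_wdigraph :: "'n wdigraph" where
  "complete_wdigraph = \<lparr>edges = {(j, i). j \<noteq> i}, weight = (\<lambda>i j. if j = i then 0 else 1)\<rparr>"

lemma admissible_complete_wdigraph: "1 \<le> amax \<Longrightarrow> admissible amax complete_wdigraph"
  by (auto simp: admissible_def complete_wdigraph_def)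

lemma laplacian_complete_graph:
  fixes x :: "real ^ 'n::finite"
  shows "laplacian complete_wdigraph x = - real CARD('n) *\<^sub>R deviation x"
proof -
  have "(\<Sum>j\<in>neighbors complete_wdigraph i. weight complete_wdigraph i j * (x $ j - x $ i))
      = (\<Sum>j\<in>UNIV. x $ j - x $ i)" for i
    by (rule sum.mono_neutral_cong_left) (auto simp: complete_wdigraph_def neighbors_def)
  then show ?thesis
    unfolding laplacian_def
    by (simp add: deviation_def vec_eq_iff sum_subtractf x_ave_def right_diff_distrib)
qed

text \<open>On the complete graph with unit weights the Laplacian is \<open>- n\<close> times the projection onto
  deviations, so a noise-free step contracts every disagreement by the same factor. This is what
  makes the recursion for the upper bound exactly solvable.\<close>

lemma V_drift_complete_graph:
  fixes x :: "real ^ 'n::finite"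
  shows "V (x + a *\<^sub>R laplacian complete_wdigraph x) = (1 - a * real CARD('n))\<^sup>2 * V x"
proof -
  have "deviation (deviation x) = deviation x"
    by (simp add: deviation_def x_ave_def vec_eq_iff sum_subtractf)
  then have "deviation (x + a *\<^sub>R laplacian complete_wdigraph x) = (1 - a * real CARD('n)) *\<^sub>R deviation x"
    by (simp add: laplacian_complete_graph linear_add[OF linear_deviation]
        linear_scale[OF linear_deviation] linear_diff[OF linear_deviation] algebra_simps)
  then show ?thesis
    by (simp add: V_eq_norm_deviation power_mult_distrib)
qed

section \<open>Mean square evolution of the disagreement\<close>

text \<open>The content of \<open>noise_A4\<close> for a single topology sequence and given constants, with
  square-integrability and orthogonality as bundled notions.\<close>

definition noise_bounded_between ::
    "'a measure \<Rightarrow> real \<Rightarrow> real \<Rightarrow> (nat \<Rightarrow> 'n::finite wdigraph) \<Rightarrow> (nat \<Rightarrow> 'n \<Rightarrow> 'n \<Rightarrow> 'a \<Rightarrow> real) \<Rightarrow> bool"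
  where
  "noise_bounded_between M vlo vhi G u \<longleftrightarrow>
     (\<forall>t\<ge>1. \<forall>(j, i)\<in>edges (G t).
        square_integrable M (u t j i) \<and> (\<integral>\<omega>. u t j i \<omega> \<partial>M) = 0) \<and>
     (\<forall>t1\<ge>1. \<forall>t2\<ge>1. t1 \<noteq> t2 \<longrightarrow>
        (\<forall>(j1, i1)\<in>edges (G t1). \<forall>(j2, i2)\<in>edges (G t2).
           orthogonal_rv M (u t1 j1 i1) (u t2 j2 i2))) \<and>
     (\<forall>t\<ge>1. edges (G t) \<noteq> {} \<longrightarrow>
        (\<forall>c :: 'n \<Rightarrow> 'n \<Rightarrow> real.
           vlo * (\<Sum>(j, i)\<in>edges (G t). (c j i)\<^sup>2)
             \<le> (\<integral>\<omega>. (\<Sum>(j, i)\<in>edges (G t). c j i * u t j i \<omega>)\<^sup>2 \<partial>M) \<and>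
           (\<integral>\<omega>. (\<Sum>(j, i)\<in>edges (G t). c j i * u t j i \<omega>)\<^sup>2 \<partial>M)
             \<le> vhi * (\<Sum>(j, i)\<in>edges (G t). (c j i)\<^sup>2)))"

lemma noise_A4_obtain_bounds:
  assumes "noise_A4 amax M w"
  obtains vlo vhi where "0 < vlo" "vlo \<le> vhi"
    "\<And>G. G \<in> topology_seqs amax \<Longrightarrow> noise_bounded_between M vlo vhi G (w G)"
  using assms unfolding noise_A4_def
proof (elim exE conjE, goal_cases)
  case (1 vlo vhi)
  have "noise_bounded_between M vlo vhi G (w G)" if "G \<in> topology_seqs amax" for G
  proof -
    note A = bspec[OF 1(4) that]
    have sq: "square_integrable M (w G t j i)" and "(\<integral>\<omega>. w G t j i \<omega> \<partial>M) = 0"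
      if "1 \<le> t" "(j, i) \<in> edges (G t)" for t j i
      using A[THEN conjunct1, rule_format, OF that] by (simp_all add: square_integrable_def)
    moreover have "orthogonal_rv M (w G t1 j1 i1) (w G t2 j2 i2)"
      if "1 \<le> t1" "1 \<le> t2" "t1 \<noteq> t2" "(j1, i1) \<in> edges (G t1)" "(j2, i2) \<in> edges (G t2)"
      for t1 t2 j1 i1 j2 i2
      using A[THEN conjunct2, THEN conjunct1] that sq by (fastforce simp: orthogonal_rv_def)
    ultimately show ?thesis
      unfolding noise_bounded_between_def
      by (intro conjI A[THEN conjunct2, THEN conjunct2]) auto
  qed
  with 1(2,3) show ?case by (rule 1(1))
qed

lemma noise_bounded_between_uncorrelated:
  assumes "noise_bounded_between M vlo vhi G u" "1 \<le> t1" "1 \<le> t2" "t1 \<noteq> t2"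
    and "(j1, i1) \<in> edges (G t1)" "(j2, i2) \<in> edges (G t2)"
  shows "orthogonal_rv M (u t1 j1 i1) (u t2 j2 i2)"
  using assms(1)[unfolded noise_bounded_between_def, THEN conjunct2, THEN conjunct1,
      rule_format, OF assms(2-5)] assms(6)
  by auto

lemma noise_bounded_between_variance:
  fixes c :: "'n::finite \<Rightarrow> 'n \<Rightarrow> real"
  assumes "noise_bounded_between M vlo vhi G u" "1 \<le> t" "edges (G t) \<noteq> {}"
  shows "vlo * (\<Sum>(j, i)\<in>edges (G t). (c j i)\<^sup>2)
           \<le> (\<integral>\<omega>. (\<Sum>(j, i)\<in>edges (G t). c j i * u t j i \<omega>)\<^sup>2 \<partial>M)"
    and "(\<integral>\<omega>. (\<Sum>(j, i)\<in>edges (G t). c j i * u t j i \<omega>)\<^sup>2 \<partial>M)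
           \<le> vhi * (\<Sum>(j, i)\<in>edges (G t). (c j i)\<^sup>2)"
proof -
  note B = assms(1)[unfolded noise_bounded_between_def, THEN conjunct2, THEN conjunct2,
      THEN spec, THEN mp, OF assms(2), THEN mp, OF assms(3), THEN spec, of c]
  show "vlo * (\<Sum>(j, i)\<in>edges (G t). (c j i)\<^sup>2)
           \<le> (\<integral>\<omega>. (\<Sum>(j, i)\<in>edges (G t). c j i * u t j i \<omega>)\<^sup>2 \<partial>M)"
    by (rule B[THEN conjunct1])
  show "(\<integral>\<omega>. (\<Sum>(j, i)\<in>edges (G t). c j i * u t j i \<omega>)\<^sup>2 \<partial>M)
           \<le> vhi * (\<Sum>(j, i)\<in>edges (G t). (c j i)\<^sup>2)"
    by (rule B[THEN conjunct2])
qed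

definition noise_input ::
    "(nat \<Rightarrow> 'n wdigraph) \<Rightarrow> (nat \<Rightarrow> 'n \<Rightarrow> 'n \<Rightarrow> 'a \<Rightarrow> real) \<Rightarrow> nat \<Rightarrow> 'a \<Rightarrow> real ^ 'n::finite" where
  "noise_input G u t \<omega> = (\<chi> i. \<Sum>j\<in>neighbors (G t) i. weight (G t) i j * u t j i \<omega>)"

lemma state_Suc:
  assumes "1 \<le> t"
  shows "state w a G x1 (Suc t) \<omega> =
    (state w a G x1 t \<omega> + a t *\<^sub>R laplacian (G t) (state w a G x1 t \<omega>))
      + a t *\<^sub>R noise_input G (w G) t \<omega>"
  using assms
  by (simp add: vec_eq_iff laplacian_def noise_input_def sum.distrib distrib_left)

lemma linear_drift: "linear (\<lambda>x. x + c *\<^sub>R laplacian g x)"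
  by (intro linear_compose_add linear_compose_scale_right linear_laplacian linear_ident)

lemma noise_input_orthogonal:
  assumes "square_integrable M h"
    and "\<And>j i. (j, i) \<in> edges (G t) \<Longrightarrow> orthogonal_rv M (u t j i) h"
  shows "orthogonal_rv M (\<lambda>\<omega>. noise_input G u t \<omega> $ k) h"
  unfolding noise_input_def using assms
  by (auto simp: neighbors_def intro!: orthogonal_rv_sum orthogonal_rv_cmult)

lemma noise_input_square_integrable:
  assumes "noise_bounded_between M vlo vhi G u" "1 \<le> t"
  shows "square_integrable M (\<lambda>\<omega>. noise_input G u t \<omega> $ k)"
  unfolding square_integrable_iff_orthogonal_rv_zero
  by (rule noise_input_orthogonal)
     (use assms in \<open>auto simp: noise_bounded_between_def square_integrable_zero orthogonal_rv_def\<close>)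

text \<open>The state at time \<open>t\<close> is an affine function of the noises before time \<open>t\<close>. Constants are
  orthogonal to the noises because these have mean zero, and earlier noises are orthogonal to later
  ones.\<close>

lemma state_orthogonal_noise:
  assumes "prob_space M" "noise_bounded_between M vlo vhi G (w G)"
  shows "square_integrable M (\<lambda>\<omega>. state w a G x1 t \<omega> $ k) \<and>
    (\<forall>s\<ge>1. t \<le> s \<longrightarrow> (\<forall>(j, i)\<in>edges (G s).
       orthogonal_rv M (\<lambda>\<omega>. state w a G x1 t \<omega> $ k) (w G s j i)))"
proof -
  interpret prob_space M by fact
  have si: "square_integrable M (w G s j i)" and mean: "(\<integral>\<omega>. w G s j i \<omega> \<partial>M) = 0"
    if "1 \<le> s" "(j, i) \<in> edges (G s)" for s j i
    using assms(2) that by (auto simp: noise_bounded_between_def)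
  have const: "square_integrable M (\<lambda>\<omega>. c) \<and>
    (\<forall>s\<ge>1. t \<le> s \<longrightarrow> (\<forall>(j, i)\<in>edges (G s). orthogonal_rv M (\<lambda>\<omega>. c) (w G s j i)))" for c t
    using si mean by (auto simp: orthogonal_rv_def square_integrable_def)
  show ?thesis
  proof (induction t arbitrary: k)
    case 0
    show ?case unfolding state.simps by (rule const)
  next
    case (Suc t)
    show ?case
    proof (cases "t = 0")
      case True
      then show ?thesis using const by simp
    next
      case False
      then have t: "1 \<le> t" by simp
      let ?X = "state w a G x1 t"
      let ?D = "\<lambda>\<omega>. ?X \<omega> + a t *\<^sub>R laplacian (G t) (?X \<omega>)"
      have split: "(\<lambda>\<omega>. state w a G x1 (Suc t) \<omega> $ k)
          = (\<lambda>\<omega>. ?D \<omega> $ k + a t * noise_input G (w G) t \<omega> $ k)"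
        using t by (subst state_Suc) auto
      have sq: "square_integrable M (\<lambda>\<omega>. ?D \<omega> $ k + a t * noise_input G (w G) t \<omega> $ k)"
        by (intro square_integrable_add square_integrable_cmult
            noise_input_square_integrable[OF assms(2) t] square_integrable_linear[OF linear_drift])
           (use Suc in blast)
      have orth: "orthogonal_rv M (\<lambda>\<omega>. ?D \<omega> $ k + a t * noise_input G (w G) t \<omega> $ k) (w G s j i)"
        if s: "Suc t \<le> s" and e: "(j, i) \<in> edges (G s)" for s j i
      proof (intro orthogonal_rv_add orthogonal_rv_cmult noise_input_orthogonal)
        show "square_integrable M (w G s j i)" using si s e by simp
        show "orthogonal_rv M (w G t j' i') (w G s j i)" if "(j', i') \<in> edges (G t)" for j' i'
        proof -
          have "t \<noteq> s" "1 \<le> s" using s by auto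
          then show ?thesis
            using noise_bounded_between_uncorrelated[OF assms(2) t] that e by blast
        qed
        have "orthogonal_rv M (\<lambda>\<omega>. ?X \<omega> $ l) (w G s j i)" for l
        proof -
          have "1 \<le> s" "t \<le> s" using s by auto
          then show ?thesis using Suc.IH[of l] e by blast
        qed
        then show "orthogonal_rv M (\<lambda>\<omega>. ?D \<omega> $ k) (w G s j i)"
          by (rule orthogonal_rv_linear[OF linear_drift])
      qed
      show ?thesis unfolding split using sq orth by auto
    qed
  qed
qed

lemma integrable_V:
  assumes "\<And>i. square_integrable M (\<lambda>\<omega>. X \<omega> $ i)"
  shows "integrable M (\<lambda>\<omega>. V (X \<omega>))"
proof -
  have "integrable M (\<lambda>\<omega>. (deviation (X \<omega>) $ i)\<^sup>2)" for i
    using square_integrable_linear[OF linear_deviation assms] by (simp add: square_integrable_def)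
  then show ?thesis
    unfolding V_def by (simp add: deviation_def)
qed

lemma expectation_V_add_orthogonal:
  assumes orth: "\<And>i j. orthogonal_rv M (\<lambda>\<omega>. X \<omega> $ i) (\<lambda>\<omega>. Y \<omega> $ j)"
  shows "(\<integral>\<omega>. V (X \<omega> + Y \<omega>) \<partial>M) = (\<integral>\<omega>. V (X \<omega>) \<partial>M) + (\<integral>\<omega>. V (Y \<omega>) \<partial>M)"
proof -
  have "orthogonal_rv M (\<lambda>\<omega>. deviation (X \<omega>) $ k) (\<lambda>\<omega>. Y \<omega> $ j)" for k j
    by (rule orthogonal_rv_linear[OF linear_deviation]) (rule orth)
  then have "orthogonal_rv M (\<lambda>\<omega>. deviation (Y \<omega>) $ k) (\<lambda>\<omega>. deviation (X \<omega>) $ k)" for k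
    by (intro orthogonal_rv_linear[OF linear_deviation]) (rule orthogonal_rv_sym)
  then have o: "orthogonal_rv M (\<lambda>\<omega>. deviation (X \<omega>) $ k) (\<lambda>\<omega>. deviation (Y \<omega>) $ k)" for k
    by (rule orthogonal_rv_sym)
  then have int: "integrable M (\<lambda>\<omega>. deviation (X \<omega>) $ k * deviation (Y \<omega>) $ k)" for k
    by (auto simp: orthogonal_rv_def intro: square_integrable_integrable_mult)
  have "integrable M (\<lambda>\<omega>. V (X \<omega>))" "integrable M (\<lambda>\<omega>. V (Y \<omega>))"
    by (rule integrable_V; use orth in \<open>simp add: orthogonal_rv_def\<close>)+
  moreover have "integrable M (\<lambda>\<omega>. deviation (X \<omega>) \<bullet> deviation (Y \<omega>))"
    and "(\<integral>\<omega>. deviation (X \<omega>) \<bullet> deviation (Y \<omega>) \<partial>M) = 0"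
    unfolding inner_vec_def using int o by (auto simp: orthogonal_rv_def)
  ultimately show ?thesis
    by (simp add: V_add)
qed

text \<open>The one-step identity behind both bounds: the cross term between the contracted state and the
  fresh noise vanishes by orthogonality.\<close>

lemma expectation_V_state_Suc:
  assumes "prob_space M" "noise_bounded_between M vlo vhi G (w G)" "1 \<le> t"
  shows "(\<integral>\<omega>. V (state w a G x1 (Suc t) \<omega>) \<partial>M) =
    (\<integral>\<omega>. V (state w a G x1 t \<omega> + a t *\<^sub>R laplacian (G t) (state w a G x1 t \<omega>)) \<partial>M)
      + (a t)\<^sup>2 * (\<integral>\<omega>. V (noise_input G (w G) t \<omega>) \<partial>M)"
proof -
  let ?X = "state w a G x1 t"
  let ?D = "\<lambda>\<omega>. ?X \<omega> + a t *\<^sub>R laplacian (G t) (?X \<omega>)"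
  note so = state_orthogonal_noise[where w = w and G = G, OF assms(1,2), of a x1 t]
  have "orthogonal_rv M (\<lambda>\<omega>. ?X \<omega> $ l) (w G t j i)" if "(j, i) \<in> edges (G t)" for l j i
    using so[of l] assms(3) that by blast
  then have "orthogonal_rv M (\<lambda>\<omega>. ?D \<omega> $ k) (w G t j i)" if "(j, i) \<in> edges (G t)" for k j i
    using that by (intro orthogonal_rv_linear[OF linear_drift]) blast
  moreover have "square_integrable M (\<lambda>\<omega>. ?D \<omega> $ k)" for k
    by (rule square_integrable_linear[OF linear_drift]) (use so in blast)
  ultimately have
    "orthogonal_rv M (\<lambda>\<omega>. ?D \<omega> $ k) (\<lambda>\<omega>. (a t *\<^sub>R noise_input G (w G) t \<omega>) $ l)" for k l
    by (auto intro!: orthogonal_rv_sym[OF orthogonal_rv_cmult] noise_input_orthogonal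
        intro: orthogonal_rv_sym)
  from expectation_V_add_orthogonal[of M ?D "\<lambda>\<omega>. a t *\<^sub>R noise_input G (w G) t \<omega>", OF this]
  show ?thesis
    by (simp add: state_Suc[OF assms(3)] V_scaleR del: state.simps)
qed

section \<open>Bounds on the injected noise\<close>

text \<open>The coefficients are written as a single sum over edges because the covariance bounds are
  available only for such sums.\<close>

lemma deviation_noise_input:
  fixes G :: "nat \<Rightarrow> 'n::finite wdigraph"
  shows "deviation (noise_input G u t \<omega>) $ i =
    (\<Sum>(j, k)\<in>edges (G t). (((if k = i then 1 else 0) - 1 / real CARD('n)) * weight (G t) k j)
       * u t j k \<omega>)"
proof -
  let ?f = "\<lambda>j k. weight (G t) k j * u t j k \<omega>"
  have all: "(\<Sum>k\<in>UNIV. c k * (\<Sum>j\<in>neighbors (G t) k. ?f j k))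
      = (\<Sum>(j, k)\<in>edges (G t). c k * ?f j k)" for c :: "'n \<Rightarrow> real"
  proof -
    have "(\<Sum>k\<in>UNIV. c k * (\<Sum>j\<in>neighbors (G t) k. ?f j k))
        = (\<Sum>(k, j)\<in>(SIGMA k:UNIV. neighbors (G t) k). c k * ?f j k)"
      by (simp add: sum_distrib_left sum.Sigma)
    also have "\<dots> = (\<Sum>(j, k)\<in>edges (G t). c k * ?f j k)"
      by (rule sum.reindex_bij_witness[where i = "\<lambda>(j, k). (k, j)" and j = "\<lambda>(k, j). (j, k)"])
         (auto simp: neighbors_def)
    finally show ?thesis .
  qed
  have "deviation (noise_input G u t \<omega>) $ i =
    (\<Sum>k\<in>UNIV. ((if k = i then 1 else 0) - 1 / real CARD('n)) *
       (\<Sum>j\<in>neighbors (G t) k. ?f j k))"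
    by (simp add: deviation_def noise_input_def x_ave_def left_diff_distrib sum_subtractf
        sum_divide_distrib if_distrib[of "\<lambda>x. x * _"] cong: if_cong)
  then show ?thesis
    unfolding all by (simp add: mult.assoc)
qed

lemma expectation_V_noise_input:
  assumes "noise_bounded_between M vlo vhi G u" "1 \<le> t"
  shows "(\<integral>\<omega>. V (noise_input G u t \<omega>) \<partial>M)
    = (\<Sum>i\<in>UNIV. \<integral>\<omega>. (deviation (noise_input G u t \<omega>) $ i)\<^sup>2 \<partial>M)"
proof -
  have "integrable M (\<lambda>\<omega>. (deviation (noise_input G u t \<omega>) $ i)\<^sup>2)" for i
    using square_integrable_linear[OF linear_deviation noise_input_square_integrable[OF assms]]
    by (simp add: square_integrable_def)
  then show ?thesis
    unfolding V_def by (simp add: deviation_def)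
qed

text \<open>One edge suffices. Its noise enters the deviation of the receiver with coefficient at least
  \<open>1 - 1/n \<ge> 1/2\<close>, since a single receiver moves the average by only an \<open>n\<close>-th of its own
  displacement; the square of \<open>1/2\<close> gives the factor \<open>1/4\<close>.\<close>

lemma expectation_V_noise_input_ge:
  fixes G :: "nat \<Rightarrow> 'n::finite wdigraph"
  assumes "2 \<le> CARD('n)" "0 \<le> vlo"
    and "admissible amax (G t)" "noise_bounded_between M vlo vhi G u" "1 \<le> t" "edges (G t) \<noteq> {}"
  shows "vlo / 4 \<le> (\<integral>\<omega>. V (noise_input G u t \<omega>) \<partial>M)"
proof -
  obtain j i where e: "(j, i) \<in> edges (G t)" using assms(6) by auto
  let ?c = "\<lambda>j k. ((if k = i then 1 else 0) - 1 / real CARD('n)) * weight (G t) k j"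
  have "1 / 2 * 1 \<le> (1 - 1 / real CARD('n)) * weight (G t) i j"
    using assms(1,3) e by (intro mult_mono) (auto simp: field_simps admissible_def)
  then have "(1 / 2)\<^sup>2 \<le> (?c j i)\<^sup>2"
    by (intro power_mono) auto
  also have "\<dots> \<le> (\<Sum>(j, k)\<in>edges (G t). (?c j k)\<^sup>2)"
    using member_le_sum[of "(j, i)" "edges (G t)" "\<lambda>(j, k). (?c j k)\<^sup>2"] e by (auto)
  finally have "vlo * (1 / 4) \<le> vlo * (\<Sum>(j, k)\<in>edges (G t). (?c j k)\<^sup>2)"
    by (intro mult_left_mono assms(2)) (simp add: power2_eq_square)
  also have "\<dots> \<le> (\<integral>\<omega>. (\<Sum>(j, k)\<in>edges (G t). ?c j k * u t j k \<omega>)\<^sup>2 \<partial>M)"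
    by (rule noise_bounded_between_variance(1)[OF assms(4-6)])
  also have "\<dots> = (\<integral>\<omega>. (deviation (noise_input G u t \<omega>) $ i)\<^sup>2 \<partial>M)"
    by (simp only: deviation_noise_input)
  also have "\<dots> \<le> (\<integral>\<omega>. V (noise_input G u t \<omega>) \<partial>M)"
    unfolding expectation_V_noise_input[OF assms(4,5)]
    by (rule member_le_sum) auto
  finally show ?thesis by simp
qed

lemma expectation_V_noise_input_le:
  fixes G :: "nat \<Rightarrow> 'n::finite wdigraph"
  assumes "0 \<le> vhi" "admissible amax (G t)" "noise_bounded_between M vlo vhi G u" "1 \<le> t"
  shows "(\<integral>\<omega>. V (noise_input G u t \<omega>) \<partial>M) \<le> real CARD('n) ^ 3 * (vhi * amax\<^sup>2)"
proof -
  have comp: "(\<integral>\<omega>. (deviation (noise_input G u t \<omega>) $ i)\<^sup>2 \<partial>M) \<le> real CARD('n) ^ 2 * (vhi * amax\<^sup>2)"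
    for i
  proof (cases "edges (G t) = {}")
    case True
    then show ?thesis using assms(1) by (simp add: deviation_noise_input)
  next
    case False
    let ?c = "\<lambda>j k. ((if k = i then 1 else 0) - 1 / real CARD('n)) * weight (G t) k j"
    have le: "(?c j k)\<^sup>2 \<le> amax\<^sup>2" if "(j, k) \<in> edges (G t)" for j k
    proof -
      have w: "1 \<le> weight (G t) k j" "weight (G t) k j \<le> amax"
        using assms(2) that by (auto simp: admissible_def)
      have "1 \<le> real CARD('n)" by (simp add: Suc_leI)
      then have "\<bar>(if k = i then 1 else 0) - 1 / real CARD('n)\<bar> \<le> 1"
        by (auto simp: field_simps)
      then have "\<bar>?c j k\<bar> \<le> 1 * amax"
        unfolding abs_mult using w by (intro mult_mono) auto
      then show ?thesis using w by (simp add: abs_le_square_iff[symmetric])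
    qed
    have "(\<integral>\<omega>. (deviation (noise_input G u t \<omega>) $ i)\<^sup>2 \<partial>M)
        = (\<integral>\<omega>. (\<Sum>(j, k)\<in>edges (G t). ?c j k * u t j k \<omega>)\<^sup>2 \<partial>M)"
      by (simp only: deviation_noise_input)
    also have "\<dots> \<le> vhi * (\<Sum>(j, k)\<in>edges (G t). (?c j k)\<^sup>2)"
      by (rule noise_bounded_between_variance(2)[OF assms(3,4) False])
    also have "\<dots> \<le> vhi * (real (card (edges (G t))) * amax\<^sup>2)"
      by (intro mult_left_mono assms(1) sum_bounded_above) (use le in auto)
    also have "\<dots> \<le> vhi * (real CARD('n) ^ 2 * amax\<^sup>2)"
    proof -
      have "card (edges (G t)) \<le> CARD('n \<times> 'n)" by (intro card_mono) auto
      then have "real (card (edges (G t))) \<le> real CARD('n) ^ 2"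
        by (simp add: power2_eq_square flip: of_nat_mult)
      then show ?thesis by (intro mult_left_mono mult_right_mono assms(1)) auto
    qed
    finally show ?thesis by (simp add: mult_ac)
  qed
  have "(\<Sum>i\<in>UNIV. \<integral>\<omega>. (deviation (noise_input G u t \<omega>) $ i)\<^sup>2 \<partial>M)
      \<le> real CARD('n) * (real CARD('n) ^ 2 * (vhi * amax\<^sup>2))"
    by (rule sum_bounded_above) (rule comp)
  then show ?thesis
    by (simp add: expectation_V_noise_input[OF assms(3,4)] power3_eq_cube power2_eq_square mult_ac)
qed

section \<open>Lower bound for arbitrary gains and topologies\<close>

text \<open>Minimising \<open>(1 - b)\<^sup>2 v + c b\<^sup>2\<close> over \<open>b\<close> gives \<open>b = v / (v + c)\<close> and the minimum
  \<open>v c / (v + c)\<close>, whose reciprocal is \<open>1/v + 1/c\<close>. Hence no choice of gain lets the reciprocal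
  of the mean disagreement grow by more than a constant per step. The identity in the proof shows
  that the excess over the minimum is a square divided by \<open>v + c\<close>.\<close>

lemma inverse_growth_step:
  fixes v v' b c :: real
  assumes "0 < v" "0 < c" "0 \<le> b" and step: "(max 0 (1 - b))\<^sup>2 * v + c * b\<^sup>2 \<le> v'"
  shows "0 < v'" "1 / v' \<le> 1 / v + 1 / c"
proof -
  have "v * c / (v + c) \<le> v'"
  proof (cases "b \<le> 1")
    case True
    have "(v + c) * ((1 - b)\<^sup>2 * v + c * b\<^sup>2) - v * c = ((1 - b) * v - c * b)\<^sup>2"
      by (simp add: power2_eq_square algebra_simps)
    then have "v * c \<le> (v + c) * ((1 - b)\<^sup>2 * v + c * b\<^sup>2)"
      by (metis diff_ge_0_iff_ge zero_le_power2)
    then have "v * c / (v + c) \<le> (1 - b)\<^sup>2 * v + c * b\<^sup>2"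
      using assms by (simp add: pos_divide_le_eq mult.commute)
    then show ?thesis using step True by simp
  next
    case False
    then have "1 \<le> b\<^sup>2" by simp
    then have "c * 1 \<le> c * b\<^sup>2" using assms(2) by (intro mult_left_mono) auto
    moreover have "v * c / (v + c) \<le> c"
      using assms by (simp add: pos_divide_le_eq algebra_simps)
    ultimately show ?thesis using step False by simp
  qed
  moreover have pos: "0 < v * c / (v + c)" using assms by simp
  ultimately show "0 < v'" by linarith
  have "1 / v' \<le> 1 / (v * c / (v + c))"
    using \<open>v * c / (v + c) \<le> v'\<close> pos \<open>0 < v'\<close>
    by (intro divide_left_mono mult_pos_pos) auto
  also have "\<dots> = 1 / v + 1 / c" using assms by (simp add: field_simps)
  finally show "1 / v' \<le> 1 / v + 1 / c" .
qed

text \<open>With \<open>K\<close> the bound on the Laplacian and \<open>b = a(t) K\<close>, a step over a nonempty graph satisfies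
  the hypothesis of the growth lemma, where the noise contribution \<open>a(t)\<^sup>2 vlo / 4\<close> becomes
  \<open>c b\<^sup>2\<close>; this is why \<open>c\<close> carries the factor \<open>1/K\<^sup>2\<close>. A step over the empty graph changes
  nothing.\<close>

lemma expectation_V_state_inverse_le:
  fixes x1 :: "real ^ 'n::finite"
  assumes n: "2 \<le> CARD('n)" and amax: "1 \<le> amax" and M: "prob_space M"
    and vlo: "0 < vlo" and noise: "noise_bounded_between M vlo vhi G (w G)"
    and G: "G \<in> topology_seqs amax" and a: "a \<in> gain_seqs" and x1: "0 < V x1"
  defines "c \<equiv> vlo / 4 / (2 * real CARD('n) ^ 2 * amax)\<^sup>2"
  shows "0 < (\<integral>\<omega>. V (state w a G x1 (Suc t) \<omega>) \<partial>M) \<and>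
    1 / (\<integral>\<omega>. V (state w a G x1 (Suc t) \<omega>) \<partial>M) \<le> 1 / V x1 + real t / c"
proof (induction t)
  case 0
  interpret prob_space M by fact
  show ?case using x1 by (simp add: prob_space)
next
  case (Suc t)
  let ?X = "state w a G x1 (Suc t)"
  let ?v = "\<integral>\<omega>. V (?X \<omega>) \<partial>M"
  let ?v' = "\<integral>\<omega>. V (state w a G x1 (Suc (Suc t)) \<omega>) \<partial>M"
  let ?K = "2 * real CARD('n) ^ 2 * amax"
  have K: "0 < ?K" using amax by simp
  have adm: "admissible amax (G (Suc t))" using G by (simp add: topology_seqs_def)
  have a0: "0 \<le> a (Suc t)" using a by (simp add: gain_seqs_def)
  have c: "0 < c" using vlo amax by (simp add: c_def)
  have evol: "?v' = (\<integral>\<omega>. V (?X \<omega> + a (Suc t) *\<^sub>R laplacian (G (Suc t)) (?X \<omega>)) \<partial>M)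
      + (a (Suc t))\<^sup>2 * (\<integral>\<omega>. V (noise_input G (w G) (Suc t) \<omega>) \<partial>M)"
    by (rule expectation_V_state_Suc[where w = w and G = G, OF M noise]) simp
  have sq: "square_integrable M (\<lambda>\<omega>. ?X \<omega> $ k)" for k
    using state_orthogonal_noise[where w = w and G = G, OF M noise] by blast
  have "0 < ?v' \<and> 1 / ?v' \<le> 1 / ?v + 1 / c"
  proof (cases "edges (G (Suc t)) = {}")
    case True
    then have "?v' = ?v"
      unfolding evol
      by (simp add: laplacian_def noise_input_def neighbors_def V_def x_ave_def
          zero_vec_def[symmetric])
    then show ?thesis using Suc c by simp
  next
    case False
    let ?b = "a (Suc t) * ?K"
    have b: "0 \<le> ?b" using a0 K by simp
    have "(max 0 (1 - ?b))\<^sup>2 * ?v = (\<integral>\<omega>. (max 0 (1 - ?b))\<^sup>2 * V (?X \<omega>) \<partial>M)"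
      by simp
    also have "\<dots> \<le> (\<integral>\<omega>. V (?X \<omega> + a (Suc t) *\<^sub>R laplacian (G (Suc t)) (?X \<omega>)) \<partial>M)"
      by (intro integral_mono integrable_mult_right integrable_V
          square_integrable_linear[OF linear_drift] sq V_drift_ge[OF adm] a0)
         (use amax in auto)
    finally have "(max 0 (1 - ?b))\<^sup>2 * ?v
        \<le> (\<integral>\<omega>. V (?X \<omega> + a (Suc t) *\<^sub>R laplacian (G (Suc t)) (?X \<omega>)) \<partial>M)" .
    moreover have "(a (Suc t))\<^sup>2 * (vlo / 4)
        \<le> (a (Suc t))\<^sup>2 * (\<integral>\<omega>. V (noise_input G (w G) (Suc t) \<omega>) \<partial>M)"
      by (intro mult_left_mono expectation_V_noise_input_ge[OF n _ adm noise _ False])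
         (use vlo in auto)
    moreover have "c * ?b\<^sup>2 = (a (Suc t))\<^sup>2 * (vlo / 4)"
      using amax unfolding c_def power_mult_distrib[of "a (Suc t)"] by auto
    ultimately have "(max 0 (1 - ?b))\<^sup>2 * ?v + c * ?b\<^sup>2 \<le> ?v'"
      unfolding evol by linarith
    then show ?thesis
      using inverse_growth_step[OF conjunct1[OF Suc] c b] by blast
  qed
  moreover have "real (Suc t) / c = real t / c + 1 / c"
    by (simp add: add_divide_distrib)
  ultimately show ?case using Suc by linarith
qed

section \<open>Upper bound on the complete graph\<close>

text \<open>With gain \<open>1/(n t)\<close> the contraction factor at time \<open>t\<close> is \<open>((t - 1)/t)\<^sup>2\<close>, so
  \<open>t\<^sup>2 E V(x(t + 1))\<close> telescopes: each step adds at most a constant. The factor \<open>t\<^sup>2\<close> also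
  annihilates the initial disagreement at \<open>t = 0\<close>, which the first step wipes out.\<close>

lemma expectation_V_state_complete_graph:
  fixes x1 :: "real ^ 'n::finite"
  assumes amax: "1 \<le> amax" and M: "prob_space M" and vhi: "0 \<le> vhi"
  defines "G \<equiv> \<lambda>t::nat. complete_wdigraph :: 'n wdigraph"
    and "a \<equiv> \<lambda>t. 1 / (real CARD('n) * real t)"
  assumes noise: "noise_bounded_between M vlo vhi G (w G)"
  shows "(real t)\<^sup>2 * (\<integral>\<omega>. V (state w a G x1 (Suc t) \<omega>) \<partial>M)
    \<le> real t * (real CARD('n) * (vhi * amax\<^sup>2))"
proof (induction t)
  case 0
  show ?case by simp
next
  case (Suc t)
  let ?n = "real CARD('n)" and ?s = "real (Suc t)"
  let ?X = "state w a G x1 (Suc t)"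
  let ?N = "\<integral>\<omega>. V (noise_input G (w G) (Suc t) \<omega>) \<partial>M"
  have an: "1 - a (Suc t) * ?n = real t / ?s"
  proof -
    have "a (Suc t) * ?n = 1 / ?s" by (simp add: a_def del: of_nat_Suc)
    then show ?thesis by (simp add: field_simps)
  qed
  have "(\<integral>\<omega>. V (state w a G x1 (Suc (Suc t)) \<omega>) \<partial>M)
      = (real t / ?s)\<^sup>2 * (\<integral>\<omega>. V (?X \<omega>) \<partial>M) + (a (Suc t))\<^sup>2 * ?N"
    by (subst expectation_V_state_Suc[where w = w and G = G, OF M noise])
       (simp_all add: G_def V_drift_complete_graph an del: of_nat_Suc state.simps)
  then have "?s\<^sup>2 * (\<integral>\<omega>. V (state w a G x1 (Suc (Suc t)) \<omega>) \<partial>M)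
      = (real t)\<^sup>2 * (\<integral>\<omega>. V (?X \<omega>) \<partial>M) + ?N / ?n\<^sup>2"
    by (simp add: a_def power_divide power_mult_distrib distrib_left del: of_nat_Suc state.simps)
  moreover have "?N / ?n\<^sup>2 \<le> ?n ^ 3 * (vhi * amax\<^sup>2) / ?n\<^sup>2"
    by (intro divide_right_mono expectation_V_noise_input_le[OF vhi _ noise])
       (auto simp: G_def admissible_complete_wdigraph[OF amax])
  moreover have "?n ^ 3 * (vhi * amax\<^sup>2) / ?n\<^sup>2 = ?n * (vhi * amax\<^sup>2)"
    by (simp add: power3_eq_cube power2_eq_square)
  moreover have "?s * (?n * (vhi * amax\<^sup>2)) = real t * (?n * (vhi * amax\<^sup>2)) + ?n * (vhi * amax\<^sup>2)"
    by (simp add: distrib_right)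
  ultimately show ?case using Suc by linarith
qed

section \<open>The optimal rate\<close>

lemma rho1_le:
  fixes w :: "('n::finite, 'a) noise"
  assumes "a \<in> gain_seqs" "G \<in> topology_seqs amax"
  shows "rho1 amax M w x1 t \<le> (\<integral>\<omega>. V (state w a G x1 t \<omega>) \<partial>M)"
proof -
  have nonneg: "0 \<le> (\<integral>\<omega>. V (state w a G x1 t \<omega>) \<partial>M)" for a and G :: "nat \<Rightarrow> 'n wdigraph"
    by (simp add: V_nonneg)
  have ne: "topology_seqs amax \<noteq> ({} :: (nat \<Rightarrow> 'n wdigraph) set)" using assms by auto
  have "rho1 amax M w x1 t \<le> (INF G\<in>topology_seqs amax. \<integral>\<omega>. V (state w a G x1 t \<omega>) \<partial>M)"
    unfolding rho1_def
    by (rule cINF_lower[OF _ assms(1)]) (auto intro!: bdd_belowI2[where m = 0] cINF_greatest ne nonneg)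
  also have "\<dots> \<le> (\<integral>\<omega>. V (state w a G x1 t \<omega>) \<partial>M)"
    by (rule cINF_lower[OF _ assms(2)]) (auto intro!: bdd_belowI2[where m = 0] nonneg)
  finally show ?thesis .
qed

lemma rho1_ge:
  fixes w :: "('n::finite, 'a) noise"
  assumes "1 \<le> amax"
    and "\<And>a G. a \<in> gain_seqs \<Longrightarrow> G \<in> topology_seqs amax \<Longrightarrow>
      m \<le> (\<integral>\<omega>. V (state w a G x1 t \<omega>) \<partial>M)"
  shows "m \<le> rho1 amax M w x1 t"
proof -
  have "(\<lambda>_. complete_wdigraph :: 'n wdigraph) \<in> topology_seqs amax"
    by (simp add: topology_seqs_def admissible_complete_wdigraph[OF assms(1)])
  moreover have "(\<lambda>_. 0) \<in> gain_seqs" by (simp add: gain_seqs_def)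
  ultimately have "topology_seqs amax \<noteq> ({} :: (nat \<Rightarrow> 'n wdigraph) set)" "gain_seqs \<noteq> {}"
    by blast+
  then show ?thesis
    unfolding rho1_def by (auto intro!: cINF_greatest assms(2))
qed

theorem theorem4p3:
  fixes amax :: real
    and M :: "'a measure"
    and w :: "('n::finite, 'a) noise"
    and x1 :: "real ^ 'n"
  assumes "CARD('n) \<ge> 2"
    and "amax \<ge> 1"
    and "prob_space M"
    and "noise_A4 amax M w"
    and "\<exists>i j. x1 $ i \<noteq> x1 $ j"
  shows "\<exists>c1 c2 :: real. \<exists>t0 :: nat. 0 < c1 \<and> c1 < c2 \<and> 0 < t0 \<and>
           (\<forall>t\<ge>t0. c1 * (1 / real t) \<le> rho1 amax M w x1 t \<and>
                    rho1 amax M w x1 t \<le> c2 * (1 / real t))"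
proof -
  obtain vlo vhi where vlo: "0 < vlo" "vlo \<le> vhi" and
    noise: "\<And>G. G \<in> topology_seqs amax \<Longrightarrow> noise_bounded_between M vlo vhi G (w G)"
    using noise_A4_obtain_bounds[OF assms(4)] by blast
  have V1: "0 < V x1" using assms(5) V_pos by blast
  define c where "c = vlo / 4 / (2 * real CARD('n) ^ 2 * amax)\<^sup>2"
  define C where "C = real CARD('n) * (vhi * amax\<^sup>2)"
  define c1 where "c1 = 1 / (1 / V x1 + 1 / c)"
  have c: "0 < c" using vlo assms(2) by (simp add: c_def)
  have C: "0 < C" using vlo assms(2) by (simp add: C_def)
  have c1: "0 < c1" using c V1 by (simp add: c1_def add_pos_pos)
  have lower: "c1 * (1 / real t) \<le> rho1 amax M w x1 t" if t: "2 \<le> t" for t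
  proof (rule rho1_ge[OF assms(2)])
    fix a and G :: "nat \<Rightarrow> 'n wdigraph"
    assume "a \<in> gain_seqs" "G \<in> topology_seqs amax"
    let ?v = "\<integral>\<omega>. V (state w a G x1 t \<omega>) \<partial>M"
    obtain s where s: "t = Suc s" using t by (cases t) auto
    have v: "0 < ?v" "1 / ?v \<le> 1 / V x1 + real s / c"
      using expectation_V_state_inverse_le[where w = w and G = G,
          OF assms(1-3) vlo(1) noise \<open>G \<in> topology_seqs amax\<close>
          \<open>a \<in> gain_seqs\<close> V1, of s] \<open>G \<in> topology_seqs amax\<close>
      unfolding c_def s by auto
    have "1 / V x1 * 1 \<le> 1 / V x1 * real t" using V1 t by (intro mult_left_mono) auto
    moreover have "real s / c \<le> real t / c" using c s by (intro divide_right_mono) auto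
    ultimately have "1 / ?v \<le> (1 / V x1 + 1 / c) * real t"
      using v(2) by (simp add: distrib_right)
    moreover have "(1 / V x1 + 1 / c) * real t = real t / c1" by (simp add: c1_def)
    ultimately have "1 / ?v \<le> real t / c1" by simp
    then show "c1 * (1 / real t) \<le> ?v"
      using v(1) c1 t by (simp add: field_simps)
  qed
  have upper: "rho1 amax M w x1 t \<le> (2 * C) * (1 / real t)" if t: "2 \<le> t" for t
  proof -
    let ?G = "\<lambda>t::nat. complete_wdigraph :: 'n wdigraph" and ?a = "\<lambda>t. 1 / (real CARD('n) * real t)"
    let ?v = "\<integral>\<omega>. V (state w ?a ?G x1 t \<omega>) \<partial>M"
    obtain s where s: "t = Suc s" "1 \<le> s" using t by (cases t) auto
    have G: "?G \<in> topology_seqs amax"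
      by (simp add: topology_seqs_def admissible_complete_wdigraph[OF assms(2)])
    have "(real s)\<^sup>2 * ?v \<le> real s * C"
      unfolding C_def s(1)
      by (rule expectation_V_state_complete_graph[where w = w, OF assms(2,3) _ noise[OF G]])
         (use vlo in auto)
    then have "real s * (real s * ?v) \<le> real s * C"
      by (simp add: power2_eq_square mult.assoc)
    then have "real s * ?v \<le> C"
      using s(2) by (simp add: mult_le_cancel_left_pos)
    then have "?v \<le> C / real s"
      using s(2) by (simp add: field_simps)
    \<comment> \<open>The bound on the complete graph is in terms of \<open>t - 1\<close>, which is at least \<open>t / 2\<close>.\<close>
    also have "\<dots> \<le> C / (real t / 2)"
      using s C by (intro divide_left_mono) auto
    finally have "?v \<le> (2 * C) * (1 / real t)" by (simp add: mult.commute)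
    moreover have "rho1 amax M w x1 t \<le> ?v"
      by (rule rho1_le[OF _ G]) (simp add: gain_seqs_def)
    ultimately show ?thesis by simp
  qed
  \<comment> \<open>Adding \<open>c1\<close> to the upper constant makes the two constants distinct.\<close>
  have "(2 * C) * (1 / real t) \<le> (c1 + 2 * C) * (1 / real t)" for t
    using c1 by (intro mult_right_mono) auto
  then have "\<forall>t\<ge>2. c1 * (1 / real t) \<le> rho1 amax M w x1 t \<and>
      rho1 amax M w x1 t \<le> (c1 + 2 * C) * (1 / real t)"
    using lower upper order_trans by blast
  then show ?thesis
    using c1 C by (intro exI[of _ c1] exI[of _ "c1 + 2 * C"] exI[of _ 2]) auto
qed

end
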